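(* Let $m\ge 0$ be an integer. (i) For $\alpha\in\mathbb{C}$ with $\operatorname{Re}(\alpha)>0$ and $\lambda\in\mathbb{C}\setminus\{-1\}$, $$\sum_{n=0}^{\infty}\mathcal{E}_{n+m}^{(\alpha)}(\lambda)\frac{t^{n}}{n!}=\left(\frac{2}{\lambda e^{t}+1}\right)^{\alpha}w_{m}^{(\alpha)}\!\left(\frac{-\lambda e^{t}}{\lambda e^{t}+1}\right).$$ (ii) For every integer $l\ge 1$ and $\lambda\in\mathbb{C}\setminus\{1\}$, $$\sum_{n=0}^{\infty}\binom{n+m+l}{l}^{-1}\mathcal{B}_{n+m+l}^{(l)}(\lambda)\frac{t^{n}}{n!}=l!\left(\frac{1}{\lambda e^{t}-1}\right)^{l}w_{m}^{(l)}\!\left(\frac{-\lambda e^{t}}{\lambda e^{t}-1}\right).$$ Both are identities of formal power series in $t$.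
   Context: General geometric polynomials: $w_n^{(\alpha)}(x)=\sum_{k=0}^{n}\genfrac{\{}{\}}{0pt}{}{n}{k}\binom{\alpha+k-1}{k}k!\,x^k$, with $\genfrac{\{}{\}}{0pt}{}{n}{k}$ the Stirling numbers of the second kind and $\binom{\alpha+k-1}{k}=\frac{\alpha(\alpha+1)\cdots(\alpha+k-1)}{k!}$. Apostol-Euler numbers of order $\alpha$ ($\lambda\ne-1$): $\left(\frac{2}{\lambda e^t+1}\right)^\alpha=\sum_{n\ge0}\mathcal{E}_n^{(\alpha)}(\lambda)\frac{t^n}{n!}$, where, for a fixed logarithm $L$ of $\lambda+1$ (e.g. the principal one), the power means the power series in $t$ with constant term $2^\alpha e^{-\alpha L}$. Apostol-Bernoulli numbers of order $l$ ($l\in\mathbb{N}$): $\left(\frac{t}{\lambda e^t-1}\right)^l=\sum_{n\ge0}\mathcal{B}_n^{(l)}(\lambda)\frac{t^n}{n!}$. *)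

theory Defs
  imports
    Complex_Main
    "HOL-Computational_Algebra.Computational_Algebra"
    "HOL-Combinatorics.Stirling"
begin

text \<open>
  The power \<open>F\<^sup>a\<close> of a power series with nonzero constant term, for the choice \<open>L\<close> of a
  logarithm of that constant term \<open>c\<close>: with \<open>F = c (1 + G)\<close> and \<open>G\<close> without constant term,
  \<open>F\<^sup>a = exp (a L) (1 + G)\<^sup>a\<close>, the last factor being the binomial series in \<open>G\<close>.
\<close>

definition fps_cpow :: "complex \<Rightarrow> complex fps \<Rightarrow> complex \<Rightarrow> complex fps" where
  "fps_cpow L F a =
     fps_const (exp (a * L)) * (fps_binomial a oo (F / fps_const (fps_nth F 0) - 1))"

lemma fps_cpow_nth_0: "fps_nth (fps_cpow L F a) 0 = exp (a * L)"
  by (simp add: fps_cpow_def)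

lemma fps_cpow_of_nat:
  assumes "exp L = fps_nth F 0"
  shows "fps_cpow L F (of_nat n) = F ^ n"
proof -
  define c where "c = fps_nth F 0"
  have c: "c \<noteq> 0" "exp L = c"
    using assms exp_not_eq_zero[of L] by (auto simp: c_def)
  have F: "F / fps_const c = F * fps_const (inverse c)"
    using c by (simp add: fps_divide_unit fps_const_inverse)
  have G0: "fps_nth (F / fps_const c - 1) 0 = 0"
    unfolding F using c by (simp add: c_def)
  have comp: "fps_binomial (of_nat n) oo G = (1 + G) ^ n" if "fps_nth G 0 = 0" for G :: "complex fps"
    using that by (simp add: fps_binomial_of_nat fps_compose_add_distrib flip: fps_compose_power)
  have "fps_binomial (of_nat n) oo (F / fps_const c - 1) = (F / fps_const c) ^ n"
    using comp[OF G0] by simp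
  also have "\<dots> = F ^ n * fps_const (inverse c ^ n)"
    unfolding F by (simp add: power_mult_distrib fps_const_power)
  finally show ?thesis
    using c by (simp add: fps_cpow_def exp_of_nat_mult power_inverse mult.left_commute[of "fps_const _"]
        fps_const_mult[symmetric] del: fps_const_mult flip: c_def)
qed

definition geom_poly :: "complex \<Rightarrow> nat \<Rightarrow> complex poly" where
  "geom_poly \<alpha> n =
     (\<Sum>k\<le>n. monom (of_nat (Stirling n k) * ((\<alpha> + of_nat k - 1) gchoose k) * fact k) k)"

text \<open>
  Evaluation of a polynomial at a power series, which may have a nonzero constant term
  (so \<^const>\<open>fps_compose\<close> is not applicable).
\<close>

definition poly_at_fps :: "complex poly \<Rightarrow> complex fps \<Rightarrow> complex fps" where
  "poly_at_fps p F = poly (map_poly fps_const p) F"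

text \<open>
  \<open>(2 / (lam e\<^sup>t + 1))\<^sup>\<alpha>\<close>, where \<open>L\<close> is a logarithm of \<open>lam + 1\<close>; its constant term is
  \<open>exp (\<alpha> (ln 2 - L)) = 2\<^sup>\<alpha> exp (- \<alpha> L)\<close>.
\<close>

definition apostol_euler_fps :: "complex \<Rightarrow> complex \<Rightarrow> complex \<Rightarrow> complex fps" where
  "apostol_euler_fps L \<alpha> lam =
     fps_cpow (of_real (ln 2) - L) (2 / (fps_const lam * fps_exp 1 + 1)) \<alpha>"

definition apostol_euler :: "complex \<Rightarrow> complex \<Rightarrow> complex \<Rightarrow> nat \<Rightarrow> complex" where
  "apostol_euler L \<alpha> lam n = fact n * fps_nth (apostol_euler_fps L \<alpha> lam) n"

definition apostol_bernoulli :: "nat \<Rightarrow> complex \<Rightarrow> nat \<Rightarrow> complex" where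
  "apostol_bernoulli l lam n =
     fact n * fps_nth ((fps_X / (fps_const lam * fps_exp 1 - 1)) ^ l) n"

end

(*
  With y = - lam e^t / (lam e^t + s) one has y' = y (1 + y), and both F = (2 / (lam e^t + 1))^\<alpha>
  (s = 1) and F = (1 / (lam e^t - 1))^l (s = -1, \<alpha> = l) satisfy F' = \<alpha> y F. The general
  geometric polynomials w_m obey w_(m+1) = \<alpha> x w_m + x (1 + x) w_m', so by induction the m-th
  derivative of F is F w_m(y). In (ii) the factor t^l of the Bernoulli generating function shifts
  the coefficients by l, which the inverse binomial coefficient turns into l! times those of the
  m-th derivative.
*)

theory Submission
  imports Defs
begin

lemma coeff_geom_poly:
  "coeff (geom_poly \<alpha> n) k = of_nat (Stirling n k) * pochhammer \<alpha> k"
proof -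
  have "((\<alpha> + of_nat k - 1) gchoose k) * fact k = pochhammer \<alpha> k" for k
    by (simp add: gbinomial_pochhammer')
  then show ?thesis
    by (simp add: geom_poly_def coeff_sum mult.assoc if_distrib[where f = "\<lambda>x. x = _"] not_le)
qed

lemma geom_poly_0: "geom_poly \<alpha> 0 = 1"
  by (simp add: geom_poly_def)

text \<open>At \<open>x^k\<close> the two sides agree by S(n+1,k) = k S(n,k) + S(n,k-1), because the
  rising factorial contributes the factor \<alpha> + k - 1 when it passes from k - 1 to k.\<close>

lemma geom_poly_Suc:
  "geom_poly \<alpha> (Suc n) = [:0, \<alpha>:] * geom_poly \<alpha> n + [:0, 1, 1:] * pderiv (geom_poly \<alpha> n)"
proof (rule poly_eqI)
  fix k
  show "coeff (geom_poly \<alpha> (Suc n)) k =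
      coeff ([:0, \<alpha>:] * geom_poly \<alpha> n + [:0, 1, 1:] * pderiv (geom_poly \<alpha> n)) k"
  proof (cases k)
    case (Suc j)
    then show ?thesis
      \<comment> \<open>The case k = 1 is separate: the \<open>x^2\<close> part of the right-hand
        side reads the coefficient of the derivative at k - 2.\<close>
      by (cases j) (simp_all add: coeff_geom_poly coeff_pderiv coeff_pCons pochhammer_Suc algebra_simps)
  qed (simp add: coeff_geom_poly)
qed

lemma poly_at_fps_0 [simp]: "poly_at_fps 0 F = 0"
  by (simp add: poly_at_fps_def)

lemma poly_at_fps_pCons [simp]: "poly_at_fps (pCons a p) F = fps_const a + F * poly_at_fps p F"
  by (simp add: poly_at_fps_def map_poly_pCons)

lemma poly_at_fps_1 [simp]: "poly_at_fps 1 F = 1"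
  by (simp add: one_pCons)

lemma poly_at_fps_add: "poly_at_fps (p + q) F = poly_at_fps p F + poly_at_fps q F"
  by (induction p q rule: poly_induct2) (simp_all add: algebra_simps flip: fps_const_add)

lemma poly_at_fps_smult: "poly_at_fps (smult a p) F = fps_const a * poly_at_fps p F"
  by (induction p) (simp_all add: algebra_simps flip: fps_const_mult)

lemma poly_at_fps_mult: "poly_at_fps (p * q) F = poly_at_fps p F * poly_at_fps q F"
  by (induction p) (simp_all add: poly_at_fps_add poly_at_fps_smult algebra_simps)

text \<open>Chain rule for an inner series with arbitrary constant term, where the rule for
  \<open>fps_compose\<close> does not apply.\<close>

lemma fps_deriv_poly_at_fps:
  "fps_deriv (poly_at_fps p F) = poly_at_fps (pderiv p) F * fps_deriv F"
  by (induction p) (simp_all add: pderiv_pCons poly_at_fps_add algebra_simps)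

lemma fps_nth_deriv_eq_geom_poly:
  assumes F: "fps_deriv F = fps_const \<alpha> * y * F" and y: "fps_deriv y = y * (1 + y)"
  shows "fps_nth_deriv m F = F * poly_at_fps (geom_poly \<alpha> m) y"
proof (induction m)
  case 0
  then show ?case by (simp add: geom_poly_0)
next
  case (Suc m)
  then show ?case
    \<comment> \<open>The defining equation differentiates \<open>F\<close> first;
      \<open>fps_nth_deriv_commute\<close> puts the new derivative outside, where the induction
      hypothesis applies.\<close>
    by (simp add: fps_nth_deriv_commute geom_poly_Suc poly_at_fps_add poly_at_fps_mult poly_at_fps_smult
        fps_deriv_poly_at_fps F y algebra_simps del: fps_nth_deriv.simps)
qed

text \<open>The choice of \<open>L\<close> enters only through a constant factor, so the logarithmic
  derivative comes from the binomial series alone.\<close>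

lemma fps_deriv_cpow:
  assumes F0: "fps_nth F 0 \<noteq> 0"
  shows "fps_deriv (fps_cpow L F a) = fps_const a * (fps_deriv F / F) * fps_cpow L F a"
proof -
  define c where "c = fps_nth F 0"
  define G where "G = F / fps_const c - 1"
  have c: "c \<noteq> 0" using F0 by (simp add: c_def)
  have Fc: "F / fps_const c = fps_const (inverse c) * F"
    using c by (simp add: fps_divide_unit fps_const_inverse)
  have F: "F = fps_const c * (1 + G)"
    using c by (simp add: G_def Fc flip: mult.assoc)
  have G0: "fps_nth G 0 = 0" using c by (simp add: G_def Fc) (simp add: c_def)
  \<comment> \<open>The differential equation (1 + X) B' = a B of the binomial series; composed with
    \<open>G\<close>, it turns 1 + X into \<open>F / c\<close>.\<close>
  have "fps_deriv (fps_binomial a) * (1 + fps_X) = fps_const a * fps_binomial a"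
    by (simp add: fps_binomial_deriv fps_divide_unit mult.assoc inverse_mult_eq_1)
  then have "(fps_deriv (fps_binomial a) * (1 + fps_X)) oo G = (fps_const a * fps_binomial a) oo G"
    by simp
  then have *: "(fps_deriv (fps_binomial a) oo G) * (1 + G) = fps_const a * (fps_binomial a oo G)"
    using G0 by (simp add: fps_compose_mult_distrib fps_compose_add_distrib)
  have "fps_deriv (fps_cpow L F a) * F = fps_const a * fps_deriv F * fps_cpow L F a"
  proof -
    have cp: "fps_cpow L F a = fps_const (exp (a * L)) * (fps_binomial a oo G)"
      by (simp add: fps_cpow_def G_def c_def)
    have "fps_deriv (fps_cpow L F a) * F =
        fps_const (exp (a * L)) * fps_const c * fps_deriv G * ((fps_deriv (fps_binomial a) oo G) * (1 + G))"
      unfolding cp using G0 by (subst F) (simp add: fps_compose_deriv mult_ac)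
    also have "\<dots> = fps_const a * fps_deriv F * fps_cpow L F a"
      unfolding * cp by (subst F) (simp add: mult_ac)
    finally show ?thesis .
  qed
  moreover have "F * inverse F = 1" using F0 by (simp add: inverse_mult_eq_1')
  ultimately show ?thesis using F0
    by (simp add: fps_divide_unit) (metis (no_types, lifting) mult.assoc mult.commute mult.right_neutral)
qed

lemma fps_nth_nth_deriv:
  fixes F :: "'a::field_char_0 fps"
  shows "fps_nth (fps_nth_deriv m F) n = fact (n + m) / fact n * fps_nth F (n + m)"
proof (induction m arbitrary: F)
  case (Suc m)
  then show ?case by (simp add: field_simps)
qed simp

text \<open>With E = \<open>lam e^t\<close> one has E' = U' = E, so the quotient rule gives y' =
  -E/U + (E/U)^2 = y + y^2. Part (i) uses s = 1, part (ii) s = -1.\<close>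

lemma fps_deriv_logistic:
  fixes lam s :: "'a::field_char_0"
  assumes "lam + s \<noteq> 0"
  defines "U \<equiv> fps_const lam * fps_exp 1 + fps_const s"
  defines "y \<equiv> - (fps_const lam * fps_exp 1) / U"
  shows "fps_deriv y = y * (1 + y)" "fps_deriv U / U = - y"
proof -
  have U0: "fps_nth U 0 \<noteq> 0" using assms by simp
  have y: "y = - (fps_const lam * fps_exp 1) * inverse U"
    using U0 by (simp add: y_def fps_divide_unit)
  have dU: "fps_deriv U = fps_const lam * fps_exp 1" by (simp add: U_def)
  show "fps_deriv U / U = - y" using U0 by (simp add: dU y fps_divide_unit)
  have "fps_deriv (inverse U) = - fps_deriv U * (inverse U)\<^sup>2"
    using U0 by (simp add: fps_inverse_deriv)
  then show "fps_deriv y = y * (1 + y)"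
    by (simp add: y dU power2_eq_square algebra_simps)
qed

lemma fps_deriv_power_of_log_deriv:
  fixes F :: "'a::comm_ring_1 fps"
  assumes "fps_deriv F = y * F"
  shows "fps_deriv (F ^ n) = fps_const (of_nat n) * y * F ^ n"
  by (induction n) (simp_all add: assms algebra_simps flip: fps_const_add)

theorem corollary7:
  fixes m :: nat
  shows
    "(\<forall>\<alpha> lam L :: complex. Re \<alpha> > 0 \<longrightarrow> lam \<noteq> -1 \<longrightarrow> exp L = lam + 1 \<longrightarrow>
        Abs_fps (\<lambda>n. apostol_euler L \<alpha> lam (n + m) / fact n) =
          apostol_euler_fps L \<alpha> lam *
          poly_at_fps (geom_poly \<alpha> m)
            (- (fps_const lam * fps_exp 1) / (fps_const lam * fps_exp 1 + 1))) \<and>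
     (\<forall>(l :: nat) (lam :: complex). l \<ge> 1 \<longrightarrow> lam \<noteq> 1 \<longrightarrow>
        Abs_fps (\<lambda>n. inverse (of_nat ((n + m + l) choose l)) *
                     apostol_bernoulli l lam (n + m + l) / fact n) =
          fact l * (1 / (fps_const lam * fps_exp 1 - 1)) ^ l *
          poly_at_fps (geom_poly (of_nat l) m)
            (- (fps_const lam * fps_exp 1) / (fps_const lam * fps_exp 1 - 1)))"
proof (intro conjI allI impI)
  fix \<alpha> lam L :: complex
  assume "lam \<noteq> -1"
  define U where "U = fps_const lam * fps_exp 1 + 1"
  define y where "y = - (fps_const lam * fps_exp 1) / U"
  have nz: "lam + 1 \<noteq> 0" using \<open>lam \<noteq> -1\<close> by (simp add: add_eq_0_iff2)
  then have U0: "fps_nth U 0 \<noteq> 0" by (simp add: U_def)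
  have y: "fps_deriv y = y * (1 + y)" and dU: "fps_deriv U / U = - y"
    using fps_deriv_logistic[OF nz] by (simp_all add: y_def U_def)
  have P: "2 / U = 2 * inverse U" using U0 by (simp add: fps_divide_unit)
  have P0: "fps_nth (2 / U) 0 \<noteq> 0" using U0 by (simp add: P)
  \<comment> \<open>Inversion negates the logarithmic derivative and the factor 2 drops out, which
    leaves \<open>y\<close>.\<close>
  have "fps_deriv (2 / U) = - (fps_deriv U / U) * (2 / U)"
    using U0 by (simp add: P fps_inverse_deriv fps_divide_unit power2_eq_square)
  then have "fps_deriv (2 / U) / (2 / U) = y"
    using P0 by (auto simp: dU)
  then have "fps_deriv (apostol_euler_fps L \<alpha> lam) = fps_const \<alpha> * y * apostol_euler_fps L \<alpha> lam"
    unfolding apostol_euler_fps_def U_def[symmetric] by (subst fps_deriv_cpow[OF P0]) simp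
  \<comment> \<open>Coefficient n of the m-th derivative is (n+m)!/n! times coefficient n+m, that
    is, the Apostol-Euler number at n+m over n!.\<close>
  from fps_nth_deriv_eq_geom_poly[OF this y, of m]
  show "Abs_fps (\<lambda>n. apostol_euler L \<alpha> lam (n + m) / fact n) =
      apostol_euler_fps L \<alpha> lam * poly_at_fps (geom_poly \<alpha> m)
        (- (fps_const lam * fps_exp 1) / (fps_const lam * fps_exp 1 + 1))"
    unfolding y_def U_def
    by (auto simp: fps_eq_iff fps_nth_nth_deriv apostol_euler_def)
next
  fix l :: nat and lam :: complex
  assume "lam \<noteq> 1"
  define U where "U = fps_const lam * fps_exp 1 - 1"
  define y where "y = - (fps_const lam * fps_exp 1) / U"
  define F where "F = (1 / U) ^ l"
  have nz: "lam + - 1 \<noteq> 0" using \<open>lam \<noteq> 1\<close> by simp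
  then have U0: "fps_nth U 0 \<noteq> 0" by (simp add: U_def)
  have "fps_const lam * fps_exp 1 + fps_const (- 1) = U"
    by (simp add: U_def flip: fps_const_neg)
  then have y: "fps_deriv y = y * (1 + y)" and dU: "fps_deriv U / U = - y"
    using fps_deriv_logistic[OF nz] by (simp_all add: y_def)
  have "fps_deriv (1 / U) = - (fps_deriv U / U) * (1 / U)"
    using U0 by (simp add: fps_inverse_deriv fps_divide_unit power2_eq_square)
  then have "fps_deriv F = fps_const (of_nat l) * y * F"
    unfolding F_def dU by (intro fps_deriv_power_of_log_deriv) simp
  note D = fps_nth_deriv_eq_geom_poly[OF this y, of m]
  \<comment> \<open>Coefficient n+m+l of the Bernoulli series is thus coefficient n+m of
    \<open>F\<close>.\<close>
  have shift: "(fps_X / U) ^ l = fps_X ^ l * F"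
    using U0 by (simp add: F_def fps_divide_unit power_mult_distrib)
  have fact_l: "(fact l :: complex fps) = fps_const (fact l)"
    using fps_of_nat[of "fact l", where 'a = complex] by simp
  \<comment> \<open>Dividing (n+m+l)! by the binomial coefficient leaves l! (n+m)!, and (n+m)!/n! is
    the factor produced by the m-th derivative.\<close>
  have "Abs_fps (\<lambda>n. inverse (of_nat ((n + m + l) choose l)) *
                     apostol_bernoulli l lam (n + m + l) / fact n) = fact l * fps_nth_deriv m F"
    unfolding fact_l apostol_bernoulli_def U_def[symmetric] shift
    by (rule fps_ext) (simp add: fps_nth_nth_deriv binomial_fact fps_X_power_mult_right_nth field_simps)
  then show "Abs_fps (\<lambda>n. inverse (of_nat ((n + m + l) choose l)) *
                     apostol_bernoulli l lam (n + m + l) / fact n) =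
          fact l * (1 / (fps_const lam * fps_exp 1 - 1)) ^ l *
          poly_at_fps (geom_poly (of_nat l) m)
            (- (fps_const lam * fps_exp 1) / (fps_const lam * fps_exp 1 - 1))"
    unfolding D by (simp add: F_def y_def U_def mult.assoc)
qed

end
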